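(* Let $(S,\cdot)$ be a semigroup satisfying (SFC+). For every $A\subseteq S$, $d^*_{\mathrm{F}}(A) = d^*(A)$, and both are equal to $$\sup\left\{\delta\ge 0 : \forall\, F\subseteq S \text{ finite},\ \exists\, s\in S,\ |F\cap As^{-1}|\ge \delta|F|\right\},$$ where $As^{-1} = \{t\in S : ts\in A\}$. Moreover, $d^*(A)$ also equals $$\sup\left\{\delta\ge 0 : \text{for every finite multiset } \mathfrak{F} \text{ in } S,\ \exists\, s\in S,\ |\mathfrak{F}\cap As^{-1}|\ge\delta|\mathfrak{F}|\right\}.$$
   Context: $(S,\cdot)$ satisfies the strong Følner condition (SFC) if for every finite $F\subseteq S$ and $\epsilon>0$ there is a finite $H\subseteq S$ with $|H\setminus fH|<\epsilon|H|$ for all $f\in F$. It satisfies (SFC+) if it satisfies (SFC) and is left cancellative or right cancellative or commutative. A left translation invariant mean on $S$ is a positive linear functional $\lambda$ of norm $1$ on bounded real functions on $S$ with $\lambda(x\mapsto f(sx))=\lambda(f)$ for all $s$; $d^*(A)=\sup\{\lambda(\mathbb{1}_A)\}$ over such means. Define $d^*_{\mathrm{F}}(A)$ as the supremum of $\delta\ge0$ such that for every finite $F\subseteq S$ and every $\epsilon>0$ there exists a finite $H\subseteq S$ with $|A\cap H|\ge\delta|H|$ and $|H\setminus fH|<\epsilon|H|$ for all $f\in F$. A finite multiset $\mathfrak{F}$ in $S$ is a finite support $F\subseteq S$ together with a function $\mathfrak{F}:F\to\mathbb{N}$; $|\mathfrak{F}|=\sum_{f\in F}\mathfrak{F}(f)$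 and, for a set $B$, $|\mathfrak{F}\cap B| = \sum_{f\in F\cap B}\mathfrak{F}(f)$. *)

theory Defs
  imports "HOL-Analysis.Analysis" "HOL-Library.Multiset"
begin

definition folner_set :: "'a::semigroup_mult set \<Rightarrow> real \<Rightarrow> 'a set \<Rightarrow> bool" where
  "folner_set F \<epsilon> H \<longleftrightarrow>
     finite H \<and> (\<forall>f\<in>F. real (card (H - (\<lambda>h. f * h) ` H)) < \<epsilon> * real (card H))"

definition SFC :: "'a::semigroup_mult itself \<Rightarrow> bool" where
  "SFC (_ :: 'a itself) \<longleftrightarrow>
     (\<forall>F :: 'a set. \<forall>\<epsilon>>0. finite F \<longrightarrow> (\<exists>H. folner_set F \<epsilon> H))"

definition left_cancellative :: "'a::semigroup_mult itself \<Rightarrow> bool" where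
  "left_cancellative (_ :: 'a itself) \<longleftrightarrow> (\<forall>a b c :: 'a. a * b = a * c \<longrightarrow> b = c)"

definition right_cancellative :: "'a::semigroup_mult itself \<Rightarrow> bool" where
  "right_cancellative (_ :: 'a itself) \<longleftrightarrow> (\<forall>a b c :: 'a. b * a = c * a \<longrightarrow> b = c)"

definition commutative_semigroup :: "'a::semigroup_mult itself \<Rightarrow> bool" where
  "commutative_semigroup (_ :: 'a itself) \<longleftrightarrow> (\<forall>a b :: 'a. a * b = b * a)"

definition SFC_plus :: "'a::semigroup_mult itself \<Rightarrow> bool" where
  "SFC_plus T \<longleftrightarrow>
     SFC T \<and> (left_cancellative T \<or> right_cancellative T \<or> commutative_semigroup T)"

text \<open>A functional on the bounded real functions is encoded as a total function
  on all real functions; its values at unbounded functions are irrelevant.\<close>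

definition linear_functional_bounded :: "(('a \<Rightarrow> real) \<Rightarrow> real) \<Rightarrow> bool" where
  "linear_functional_bounded L \<longleftrightarrow>
     (\<forall>f g. bounded (range f) \<longrightarrow> bounded (range g) \<longrightarrow>
        L (\<lambda>x. f x + g x) = L f + L g) \<and>
     (\<forall>c f. bounded (range f) \<longrightarrow> L (\<lambda>x. c * f x) = c * L f)"

definition positive_functional :: "(('a \<Rightarrow> real) \<Rightarrow> real) \<Rightarrow> bool" where
  "positive_functional L \<longleftrightarrow>
     (\<forall>f. bounded (range f) \<longrightarrow> (\<forall>x. f x \<ge> 0) \<longrightarrow> L f \<ge> 0)"

text \<open>Operator norm with respect to the supremum norm. For a positive linear functional
  the values are bounded by the value at the constant function 1, so the supremum is genuine.\<close>

definition functional_norm :: "(('a \<Rightarrow> real) \<Rightarrow> real) \<Rightarrow> real" where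
  "functional_norm L = (SUP f\<in>{f. \<forall>x. \<bar>f x\<bar> \<le> 1}. \<bar>L f\<bar>)"

definition left_invariant_mean :: "(('a::semigroup_mult \<Rightarrow> real) \<Rightarrow> real) \<Rightarrow> bool" where
  "left_invariant_mean L \<longleftrightarrow>
     linear_functional_bounded L \<and> positive_functional L \<and> functional_norm L = 1 \<and>
     (\<forall>s f. bounded (range f) \<longrightarrow> L (\<lambda>x. f (s * x)) = L f)"

text \<open>The suprema below are taken in the reals. Under SFC the sets involved are nonempty and
  bounded by 1.\<close>

definition upper_banach_density :: "'a::semigroup_mult set \<Rightarrow> real" where
  "upper_banach_density A = Sup {L (indicator A) | L. left_invariant_mean L}"

definition folner_density :: "'a::semigroup_mult set \<Rightarrow> real" where
  "folner_density A = Sup {\<delta>. \<delta> \<ge> 0 \<and>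
     (\<forall>F \<epsilon>. finite F \<longrightarrow> \<epsilon> > 0 \<longrightarrow>
        (\<exists>H. folner_set F \<epsilon> H \<and> real (card (A \<inter> H)) \<ge> \<delta> * real (card H)))}"

definition right_quotient :: "'a::semigroup_mult set \<Rightarrow> 'a \<Rightarrow> 'a set" where
  "right_quotient A s = {t. t * s \<in> A}"

end

theory Submission
  imports Defs
begin

text \<open>A mean applied to \<open>s \<mapsto> |M \<inter> A s\<inverse>|\<close> gives \<open>\<lambda>(A) |M|\<close>, so some \<open>s\<close> attains at
  least this value. Conversely, if some \<open>s\<close> is good for a Folner set \<open>H\<close>, then averaging over
  the points \<open>h s\<close> with \<open>h \<in> H\<close> is an almost invariant functional, and these functionals
  accumulate at an invariant mean by compactness. Cancellation is only needed to obtain Folner sets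
  from a mean. If right translations are injective, the set \<open>H s\<close> works. Otherwise one takes a level
  set of \<open>y \<mapsto> |{h \<in> H. h s = y}|\<close>, which succeeds as soon as \<open>f h s = f h' s\<close> implies
  \<open>h s = h' s\<close>. In the commutative case this is arranged by \<open>s = c t\<close>, where \<open>c\<close> identifies all
  pairs in \<open>H\<close> that any element identifies.\<close>

subsection \<open>Means on bounded functions\<close>

text \<open>If \<open>\<bar>f x\<bar> \<le> 1\<close> everywhere, then \<open>1 + f\<close> and
  \<open>1 - f\<close> are nonnegative, so positivity bounds \<open>\<bar>L f\<bar>\<close> by the
  value at the constant 1. This turns the norm condition on a mean into an equation at one
  coordinate, which is preserved under pointwise limits.\<close>

lemma functional_norm_positive:
  fixes L :: "('a \<Rightarrow> real) \<Rightarrow> real"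
  assumes lin: "linear_functional_bounded L" and pos: "positive_functional L"
  shows "functional_norm L = L (\<lambda>_. 1)"
proof -
  have bd: "bounded (range f)" if "\<forall>x. \<bar>f x\<bar> \<le> (1::real)" for f :: "'a \<Rightarrow> real"
    using that unfolding bounded_iff by auto
  have le: "\<bar>L f\<bar> \<le> L (\<lambda>_. 1)" if f: "\<forall>x. \<bar>f x\<bar> \<le> 1" for f
  proof -
    have c1: "bounded (range (\<lambda>_::'a. 1::real))" by (rule bd) simp
    have nf: "bounded (range (\<lambda>x. (-1) * f x))" by (rule bd) (use f in simp)
    have *: "0 \<le> L (\<lambda>x. 1 + g x)" if "\<forall>x. \<bar>g x\<bar> \<le> 1" for g
    proof -
      have "\<bar>1 + g x\<bar> \<le> 2" for x using spec[OF that, of x] by arith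
      then have "bounded (range (\<lambda>x. 1 + g x))" unfolding bounded_iff by auto
      moreover have "0 \<le> 1 + g x" for x using spec[OF that, of x] by arith
      ultimately show ?thesis using pos unfolding positive_functional_def by blast
    qed
    have "L (\<lambda>x. 1 + f x) = L (\<lambda>_. 1) + L f"
      using lin c1 bd[OF f] unfolding linear_functional_bounded_def by blast
    moreover have "L (\<lambda>x. 1 + (-1) * f x) = L (\<lambda>_. 1) + L (\<lambda>x. (-1) * f x)"
      using lin c1 nf unfolding linear_functional_bounded_def by blast
    moreover have "L (\<lambda>x. (-1) * f x) = (-1) * L f"
      using lin bd[OF f] unfolding linear_functional_bounded_def by blast
    moreover have "0 \<le> L (\<lambda>x. 1 + f x)" by (rule *[OF f])
    moreover have "0 \<le> L (\<lambda>x. 1 + (-1) * f x)" by (rule *) (use f in simp)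
    ultimately show ?thesis by linarith
  qed
  have one: "0 \<le> L (\<lambda>_. 1)"
    using le[of "\<lambda>_. 1"] by simp
  show ?thesis
    unfolding functional_norm_def
  proof (rule cSup_eq_maximum)
    show "L (\<lambda>_. 1) \<in> (\<lambda>f. \<bar>L f\<bar>) ` {f. \<forall>x. \<bar>f x\<bar> \<le> 1}"
      using one by (intro image_eqI[of _ _ "\<lambda>_. 1"]) auto
  qed (use le in auto)
qed

lemma bounded_range_indicator: "bounded (range (indicator A :: 'a \<Rightarrow> real))"
  unfolding bounded_iff by (intro exI[of _ 1]) (auto simp: indicator_def)

lemma mean_indicator_bounds:
  assumes "left_invariant_mean L"
  shows "0 \<le> L (indicator A)" "L (indicator A) \<le> 1"
proof -
  have lin: "linear_functional_bounded L" and pos: "positive_functional L"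
    and one: "L (\<lambda>_. 1) = 1"
    using assms functional_norm_positive[of L] unfolding left_invariant_mean_def by auto
  have ge: "0 \<le> L (indicator B)" for B
    using pos bounded_range_indicator[of B] unfolding positive_functional_def by simp
  show "0 \<le> L (indicator A)" by (rule ge)
  have "L (\<lambda>x. indicator A x + indicator (-A) x) = L (indicator A) + L (indicator (-A))"
    using lin bounded_range_indicator unfolding linear_functional_bounded_def by blast
  moreover have "(\<lambda>x. indicator A x + indicator (-A) x) = (\<lambda>_. 1::real)"
    by (auto simp: indicator_def)
  ultimately show "L (indicator A) \<le> 1"
    using ge[of "-A"] one by simp
qed

lemma mean_multiset_translate:
  fixes M :: "'a::semigroup_mult multiset"
  assumes L: "left_invariant_mean L"
  shows "\<exists>s. L (indicator A) * real (size M)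
           \<le> real (size (filter_mset (\<lambda>t. t \<in> right_quotient A s) M))"
proof -
  have lin: "linear_functional_bounded L" and pos: "positive_functional L"
    and one: "L (\<lambda>_. 1) = 1"
    and inv: "\<And>s f. bounded (range f) \<Longrightarrow> L (\<lambda>x. f (s * x)) = L f"
    using L functional_norm_positive[of L] unfolding left_invariant_mean_def by auto
  have L_add: "L (\<lambda>x. f x + g x) = L f + L g" if "bounded (range f)" "bounded (range g)" for f g
    using lin that unfolding linear_functional_bounded_def by blast
  have scale: "L (\<lambda>x. c * f x) = c * L f" if "bounded (range f)" for c f
    using lin that unfolding linear_functional_bounded_def by blast
  define N where "N = (\<lambda>(M::'a multiset) s. real (size (filter_mset (\<lambda>t. t \<in> right_quotient A s) M)))"
  have N_le: "0 \<le> N M s \<and> N M s \<le> real (size M)" for M s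
    by (simp add: N_def size_filter_mset_lesseq)
  have N_bd: "bounded (range (N M))" for M
    unfolding bounded_iff using N_le[of M] by (intro exI[of _ "real (size M)"]) auto
  have ind_bd: "bounded (range (\<lambda>s. indicator A (t * s) :: real))" for t
    unfolding bounded_iff by (intro exI[of _ 1]) (auto simp: indicator_def)
  \<comment> \<open>Each occurrence of \<open>t\<close> in \<open>M\<close> contributes the function
    \<open>s \<mapsto> indicator A (t * s)\<close>, a left translate of \<open>indicator A\<close>,
    so invariance gives it the value \<open>L (indicator A)\<close>.\<close>
  have LN: "L (N M) = L (indicator A) * real (size M)" for M
  proof (induction M)
    case empty
    have "L (\<lambda>x. 0 * (1::real)) = 0 * L (\<lambda>_. 1)"
      by (rule scale) simp
    then show ?case by (simp add: N_def)
  next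
    case (add t M)
    have "N (add_mset t M) = (\<lambda>s. N M s + indicator A (t * s))"
      by (auto simp: N_def right_quotient_def indicator_def)
    then have "L (N (add_mset t M)) = L (N M) + L (\<lambda>s. indicator A (t * s))"
      using L_add[OF N_bd ind_bd] by simp
    also have "L (\<lambda>s. indicator A (t * s)) = L (indicator A)"
      by (rule inv[OF bounded_range_indicator])
    finally show ?case using add by (simp add: algebra_simps)
  qed
  \<comment> \<open>The counts lie in a finite set of integers, so their maximum is attained.
    Positivity applied to the maximum minus \<open>N M\<close> then gives the bound with no
    loss.\<close>
  have "range (N M) \<subseteq> real ` {..size M}"
    by (auto simp: N_def size_filter_mset_lesseq)
  then have fin: "finite (range (N M))"
    by (rule finite_subset) simp
  then have "Max (range (N M)) \<in> range (N M)"
    by (intro Max_in) auto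
  then obtain s where s: "N M s = Max (range (N M))" by force
  have max: "N M t \<le> N M s" for t
    unfolding s using fin by (intro Max_ge) auto
  have "bounded (range (\<lambda>t. N M s * 1 + (-1) * N M t))"
    unfolding bounded_iff using N_le[of M] N_le[of M s]
    by (intro exI[of _ "2 * real (size M)"]) (smt (verit, ccfv_SIG) rangeE real_norm_def)
  then have "0 \<le> L (\<lambda>t. N M s * 1 + (-1) * N M t)"
    using pos max unfolding positive_functional_def by simp
  also have "\<dots> = L (\<lambda>t. N M s * 1) + L (\<lambda>t. (-1) * N M t)"
  proof (rule L_add)
    show "bounded (range (\<lambda>t. (-1) * N M t))"
      unfolding bounded_iff using N_le[of M] by (intro exI[of _ "real (size M)"]) auto
  qed simp
  also have "\<dots> = N M s - L (N M)"
    using scale[OF N_bd, of "-1" M] scale[of "\<lambda>_. 1" "N M s"] one by simp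
  finally have "L (N M) \<le> N M s" by simp
  then show ?thesis unfolding LN by (auto simp: N_def)
qed

text \<open>Passing to the image multiset keeps multiplicities, so \<open>p\<close> may identify
  elements of \<open>H\<close>.\<close>

lemma mean_family_translate:
  fixes p :: "'i \<Rightarrow> 'a::semigroup_mult"
  assumes L: "left_invariant_mean L" and H: "finite H"
  shows "\<exists>t. L (indicator A) * real (card H) \<le> real (card {h\<in>H. p h * t \<in> A})"
  using mean_multiset_translate[OF L, of A "image_mset p (mset_set H)"] H
  by (simp add: filter_mset_image_mset filter_mset_mset_set right_quotient_def)

subsection \<open>From Folner sets to invariant means\<close>

lemma closed_Collect_const_imp: "(c \<Longrightarrow> closed {x. P x}) \<Longrightarrow> closed {x. c \<longrightarrow> P x}"
  by (cases c) auto

text \<open>For fixed functions and scalars each condition is an equation between evaluations of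
  \<open>L\<close>, and evaluations are continuous in the product topology.\<close>

lemma closed_linear_functional_bounded:
  "closed {L :: ('a \<Rightarrow> real) \<Rightarrow> real. linear_functional_bounded L}"
  unfolding linear_functional_bounded_def
  by (intro closed_Collect_conj closed_Collect_all closed_Collect_const_imp closed_Collect_eq
      continuous_intros continuous_on_product_coordinates)

lemma closed_positive_functional:
  "closed {L :: ('a \<Rightarrow> real) \<Rightarrow> real. positive_functional L}"
  unfolding positive_functional_def
  by (intro closed_Collect_all closed_Collect_const_imp closed_Collect_le
      continuous_intros continuous_on_product_coordinates)

text \<open>Set to zero on unbounded functions, so that all averages lie in one product of
  compact intervals.\<close>

definition average :: "'i set \<Rightarrow> ('i \<Rightarrow> 'a) \<Rightarrow> ('a \<Rightarrow> real) \<Rightarrow> real" where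
  "average H g f = (if bounded (range f) then (\<Sum>h\<in>H. f (g h)) / real (card H) else 0)"

lemma average_linear:
  fixes g :: "'i \<Rightarrow> 'b"
  shows "linear_functional_bounded (average H g)"
proof -
  have "bounded (range (\<lambda>x. f x + f' x))" if "bounded (range f)" "bounded (range f')"
    for f f' :: "'b \<Rightarrow> real"
    using bounded_plus_comp[OF that] .
  moreover have "bounded (range (\<lambda>x. c * f x))" if "bounded (range f)" for c and f :: "'b \<Rightarrow> real"
    using bounded_scaleR_comp[OF that, of c] by simp
  ultimately show ?thesis
    unfolding linear_functional_bounded_def average_def
    by (auto simp: sum.distrib add_divide_distrib sum_distrib_left[symmetric])
qed

lemma average_positive: "positive_functional (average H g)"
  unfolding positive_functional_def average_def by (auto intro!: divide_nonneg_nonneg sum_nonneg)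

lemma average_one:
  assumes "finite H" "H \<noteq> {}"
  shows "average H g (\<lambda>_. 1) = 1"
  using assms by (simp add: average_def)

lemma average_indicator:
  assumes "finite H"
  shows "average H g (indicator A) = real (card {h\<in>H. g h \<in> A}) / real (card H)"
proof -
  have "(\<Sum>h\<in>H. indicator A (g h) :: real) = real (card {h\<in>H. g h \<in> A})"
    using assms by (simp add: indicator_def sum.If_cases Int_def)
  then show ?thesis using bounded_range_indicator[of A] by (simp add: average_def)
qed

text \<open>Left translation need not be injective, but it is injective on a subset of \<open>H\<close>
  that maps onto \<open>s * H \<inter> H\<close>, and the Folner condition makes this subset large.\<close>

lemma sum_translate_diff:
  fixes k :: "'a::semigroup_mult \<Rightarrow> real"
  assumes H: "finite H" and k: "\<And>x. \<bar>k x\<bar> \<le> C"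
  shows "\<bar>(\<Sum>h\<in>H. k (s * h)) - (\<Sum>h\<in>H. k h)\<bar> \<le> 2 * C * real (card (H - (\<lambda>h. s * h) ` H))"
proof -
  let ?T = "(\<lambda>h. s * h) ` H"
  \<comment> \<open>\<open>P\<close> contains exactly one preimage in \<open>H\<close> of each point
    of \<open>H \<inter> ?T\<close>.\<close>
  have "H \<inter> ?T \<subseteq> (\<lambda>h. s * h) ` H" by blast
  then obtain P where P: "P \<subseteq> H" "inj_on (\<lambda>h. s * h) P" "H \<inter> ?T = (\<lambda>h. s * h) ` P"
    unfolding subset_image_inj by blast
  have finP: "finite P" using P H finite_subset by blast
  have cardP: "card P = card (H \<inter> ?T)" using P by (simp add: card_image)
  have "card (H - P) = card H - card P" using finP P by (simp add: card_Diff_subset)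
  also have "\<dots> = card (H - ?T)" unfolding cardP using H by (simp add: card_Diff_subset_Int)
  finally have cHP: "card (H - P) = card (H - ?T)" .
  have "(\<Sum>h\<in>H. k (s * h)) = (\<Sum>h\<in>H - P. k (s * h)) + (\<Sum>h\<in>P. k (s * h))"
    using H P by (intro sum.subset_diff) auto
  also have "(\<Sum>h\<in>P. k (s * h)) = (\<Sum>y\<in>H \<inter> ?T. k y)"
    unfolding P(3) using P(2) by (simp add: sum.reindex)
  finally have 1: "(\<Sum>h\<in>H. k (s * h)) = (\<Sum>h\<in>H - P. k (s * h)) + (\<Sum>y\<in>H \<inter> ?T. k y)" .
  have 2: "(\<Sum>h\<in>H. k h) = (\<Sum>h\<in>H \<inter> ?T. k h) + (\<Sum>h\<in>H - ?T. k h)"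
    using H by (rule sum.Int_Diff)
  have bound: "\<bar>\<Sum>h\<in>X. k (q h)\<bar> \<le> C * real (card X)" for X and q :: "'a \<Rightarrow> 'a"
    using sum_norm_bound[of X "\<lambda>h. k (q h)" C] k by (simp add: mult.commute)
  \<comment> \<open>The sums over \<open>H \<inter> ?T\<close> cancel. What remains is one sum over
    \<open>H - P\<close> and one over \<open>H - ?T\<close>, sets of equal size.\<close>
  show ?thesis
    using bound[of "\<lambda>h. s * h" "H - P"] bound[of "\<lambda>h. h" "H - ?T"] 1 2 cHP by simp
qed

text \<open>Limits of averages over the points \<open>g h\<close> with \<open>h \<in> H\<close> are
  taken by the finite intersection property. The condition on \<open>g\<close> transfers the almost
  invariance of \<open>H\<close> to these points; it covers both the identity and right
  translations.\<close>

lemma exists_mean: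
  fixes A :: "'a::semigroup_mult set"
  assumes approx: "\<And>F \<epsilon>. finite F \<Longrightarrow> \<epsilon> > 0 \<Longrightarrow>
      \<exists>H g. folner_set F \<epsilon> H \<and> (\<forall>x y. g (x * y) = x * g y) \<and>
            \<delta> * real (card H) \<le> real (card {h\<in>H. g h \<in> A})"
  shows "\<exists>L. left_invariant_mean L \<and> \<delta> \<le> L (indicator A)"
proof -
  \<comment> \<open>The supremum norm, set to zero on unbounded functions to match
    \<open>average\<close>.\<close>
  define B where "B = (\<lambda>f :: 'a \<Rightarrow> real. if bounded (range f) then SUP x. \<bar>f x\<bar> else 0)"
  have B: "\<bar>f x\<bar> \<le> B f" if "bounded (range f)" for f x
  proof -
    have "bdd_above (range (\<lambda>x. \<bar>f x\<bar>))"
      using that unfolding bounded_iff bdd_above_def by auto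
    then show ?thesis unfolding B_def using that by (auto intro: cSUP_upper)
  qed
  have B0: "0 \<le> B f" for f
    using B[of f undefined] by (cases "bounded (range f)") (auto simp: B_def)
  define K where "K = (\<Pi>\<^sub>E f\<in>UNIV. {- B f .. B f})"
  \<comment> \<open>Tychonoff's theorem.\<close>
  have K: "compact K"
    using compactin_PiE[of "\<lambda>_. euclidean" UNIV "\<lambda>f. {- B f .. B f}"]
    unfolding K_def by (simp add: euclidean_product_topology)
  define M where "M = {L :: ('a \<Rightarrow> real) \<Rightarrow> real. linear_functional_bounded L \<and> positive_functional L
      \<and> L (\<lambda>_. 1) = 1 \<and> \<delta> \<le> L (indicator A)}"
  have "closed M"
    unfolding M_def
    by (intro closed_Collect_conj closed_linear_functional_bounded closed_positive_functional
        closed_Collect_eq closed_Collect_le continuous_intros continuous_on_product_coordinates)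
  with K have KM: "compact (K \<inter> M)" by (rule compact_Int_closed)
  \<comment> \<open>Invariance is split into closed conditions, one for each \<open>s\<close>, each
    bounded \<open>f\<close> and each error, so that finitely many of them can be met by a single
    average.\<close>
  define I where "I = {(s::'a, f::'a \<Rightarrow> real, \<epsilon>::real). bounded (range f) \<and> \<epsilon> > 0}"
  define C where "C = (\<lambda>(s::'a, f, \<epsilon>). {L :: ('a \<Rightarrow> real) \<Rightarrow> real. \<bar>L (\<lambda>x. f (s * x)) - L f\<bar> \<le> \<epsilon>})"
  have "(K \<inter> M) \<inter> (\<Inter>i\<in>I. C i) \<noteq> {}"
  proof (rule compact_imp_fip_image[OF KM])
    show "closed (C i)" for i
      unfolding C_def
      by (cases i) (auto intro!: closed_Collect_le continuous_intros continuous_on_product_coordinates)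
  next
    fix J assume J: "finite J" "J \<subseteq> I"
    \<comment> \<open>With \<open>F\<close> nonempty, the strict Folner inequality forces
      \<open>H\<close> to be nonempty.\<close>
    define F where "F = insert undefined (fst ` J)"
    \<comment> \<open>Chosen so that \<open>2 * B f * E \<le> \<epsilon>\<close> for every triple in
      \<open>J\<close>. The summand 1 avoids a zero denominator, and the inserted 1 covers empty
      \<open>J\<close>.\<close>
    define E where "E = Min (insert 1 ((\<lambda>(s, f, \<epsilon>). \<epsilon> / (2 * B f + 1)) ` J))"
    have "E > 0"
      unfolding E_def using J B0 by (subst Min_gr_iff) (auto simp: I_def add_nonneg_pos)
    have "finite F" using J by (simp add: F_def)
    obtain H g where H: "folner_set F E H" and g: "\<And>x y. g (x * y) = x * g y"
      and A: "\<delta> * real (card H) \<le> real (card {h\<in>H. g h \<in> A})"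
      using approx[OF \<open>finite F\<close> \<open>E > 0\<close>] by blast
    have finH: "finite H" and neH: "H \<noteq> {}"
      using H by (auto simp: folner_set_def F_def)
    then have cH: "0 < real (card H)" by (simp add: card_gt_0_iff)
    have "average H g \<in> M"
      using A cH
      by (simp add: M_def pos_le_divide_eq average_linear average_positive
          average_one[OF finH neH] average_indicator[OF finH])
    moreover have "average H g \<in> K"
    proof -
      have "\<bar>average H g f\<bar> \<le> B f" for f
      proof (cases "bounded (range f)")
        case True
        have "\<bar>\<Sum>h\<in>H. f (g h)\<bar> \<le> real (card H) * B f"
          using sum_norm_bound[of H "\<lambda>h. f (g h)" "B f"] B[OF True] by simp
        then show ?thesis
          using True cH by (simp add: average_def abs_divide pos_divide_le_eq mult.commute)
      qed (simp add: average_def B0)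
      then show ?thesis unfolding K_def by (auto simp: abs_le_iff minus_le_iff)
    qed
    moreover have "average H g \<in> C (s, f, \<epsilon>)" if i: "(s, f, \<epsilon>) \<in> J" for s f \<epsilon>
    proof -
      have bf: "bounded (range f)" using i J by (auto simp: I_def)
      have bfs: "bounded (range (\<lambda>x. f (s * x)))"
        using bf by (rule bounded_subset) auto
      have "s \<in> F" using i by (force simp: F_def)
      have "E \<le> \<epsilon> / (2 * B f + 1)"
        unfolding E_def using i J by (intro Min_le) (auto intro: rev_image_eqI)
      then have E: "E * (2 * B f + 1) \<le> \<epsilon>"
        using B0[of f] by (subst (asm) pos_le_divide_eq) auto
      have "\<bar>(\<Sum>h\<in>H. f (g (s * h))) - (\<Sum>h\<in>H. f (g h))\<bar>
          \<le> 2 * B f * real (card (H - (\<lambda>h. s * h) ` H))"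
        by (rule sum_translate_diff[OF finH, of "\<lambda>h. f (g h)"]) (rule B[OF bf])
      also have "\<dots> \<le> 2 * B f * (E * real (card H))"
        using H \<open>s \<in> F\<close> B0 by (intro mult_left_mono) (auto simp: folner_set_def less_imp_le)
      also have "\<dots> \<le> \<epsilon> * real (card H)"
      proof -
        have "2 * B f * E \<le> \<epsilon>" using E \<open>E > 0\<close> by (simp add: algebra_simps)
        from mult_right_mono[OF this, of "real (card H)"] show ?thesis by (simp add: mult.assoc)
      qed
      finally show ?thesis
        using bf bfs cH
        by (simp add: C_def average_def g abs_divide pos_divide_le_eq flip: diff_divide_distrib)
    qed
    ultimately have "average H g \<in> (K \<inter> M) \<inter> (\<Inter>i\<in>J. C i)" by auto
    then show "(K \<inter> M) \<inter> (\<Inter>i\<in>J. C i) \<noteq> {}" by blast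
  qed
  then obtain L where LM: "L \<in> M" and LC: "\<And>i. i \<in> I \<Longrightarrow> L \<in> C i" by blast
  have "L (\<lambda>x. f (s * x)) = L f" if "bounded (range f)" for s f
  proof -
    have "\<bar>L (\<lambda>x. f (s * x)) - L f\<bar> \<le> 0 + \<epsilon>" if "\<epsilon> > 0" for \<epsilon>
      using LC[of "(s, f, \<epsilon>)"] that \<open>bounded (range f)\<close> by (simp add: I_def C_def)
    then have "\<bar>L (\<lambda>x. f (s * x)) - L f\<bar> \<le> 0" by (rule field_le_epsilon)
    then show ?thesis by simp
  qed
  then have "left_invariant_mean L"
    using LM functional_norm_positive[of L] by (simp add: M_def left_invariant_mean_def)
  then show ?thesis using LM by (auto simp: M_def)
qed

subsection \<open>Level sets of the pushforward of a Folner set\<close>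

text \<open>Double counting: \<open>y\<close> is counted at the levels from \<open>m y\<close> up to
  \<open>c y - 1\<close>, whose number is the truncated difference.\<close>

lemma sum_card_levels:
  fixes c :: "'b \<Rightarrow> nat"
  assumes "finite X" "\<And>y. y \<in> X \<Longrightarrow> c y \<le> n"
  shows "(\<Sum>i<n. card {y\<in>X. m y \<le> i \<and> i < c y}) = (\<Sum>y\<in>X. c y - m y)"
proof -
  have "(\<Sum>i<n. card {y\<in>X. m y \<le> i \<and> i < c y})
      = (\<Sum>i<n. \<Sum>y\<in>X. if m y \<le> i \<and> i < c y then 1 else 0)"
    using assms(1) by (simp add: sum.If_cases Int_def)
  also have "\<dots> = (\<Sum>y\<in>X. \<Sum>i<n. if m y \<le> i \<and> i < c y then 1 else 0)"
    by (rule sum.swap)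
  also have "\<dots> = (\<Sum>y\<in>X. card {m y ..< c y})"
  proof (rule sum.cong[OF refl])
    fix y assume "y \<in> X"
    then have "{i. i < n \<and> m y \<le> i \<and> i < c y} = {m y ..< c y}"
      using assms(2)[of y] by auto
    then show "(\<Sum>i<n. if m y \<le> i \<and> i < c y then 1 else 0) = card {m y ..< c y}"
      by (simp add: sum.If_cases Int_def del: card_atLeastLessThan)
  qed
  finally show ?thesis by simp
qed

lemma sum_card_fibres:
  assumes "finite X" "finite Y"
  shows "(\<Sum>y\<in>Y. card {x\<in>X. g x = y}) = card {x\<in>X. g x \<in> Y}"
proof -
  have "{x\<in>X. g x \<in> Y} = (\<Union>y\<in>Y. {x\<in>X. g x = y})" by auto
  then show ?thesis using assms by (simp only:) (subst card_UN_disjoint, auto)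
qed

text \<open>These are the superlevel sets of the multiplicity function of the pushforward of
  \<open>H\<close> under \<open>g\<close>. The strict inequality makes level 0 the whole image, and
  a point of multiplicity \<open>k\<close> lies in exactly the levels below
  \<open>k\<close>.\<close>

definition level_set :: "('a \<Rightarrow> 'b) \<Rightarrow> 'a set \<Rightarrow> nat \<Rightarrow> 'b set" where
  "level_set g H i = {y \<in> g ` H. i < card {h\<in>H. g h = y}}"

lemma finite_level_set: "finite H \<Longrightarrow> finite (level_set g H i)"
  by (simp add: level_set_def)

lemma sum_card_level_set:
  assumes "finite H"
  shows "(\<Sum>i<card H. card (A \<inter> level_set g H i)) = card {h\<in>H. g h \<in> A}"
proof -
  have "(\<Sum>i<card H. card (A \<inter> level_set g H i))
      = (\<Sum>i<card H. card {y \<in> A \<inter> g ` H. (0::nat) \<le> i \<and> i < card {h\<in>H. g h = y}})"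
    by (intro sum.cong arg_cong[of _ _ card]) (auto simp: level_set_def)
  also have "\<dots> = (\<Sum>y\<in>A \<inter> g ` H. card {h\<in>H. g h = y} - 0)"
    using assms by (intro sum_card_levels) (auto intro: card_mono)
  also have "\<dots> = card {h\<in>H. g h \<in> A \<inter> g ` H}"
    using assms by (simp only: diff_zero) (intro sum_card_fibres, auto)
  also have "{h\<in>H. g h \<in> A \<inter> g ` H} = {h\<in>H. g h \<in> A}" by auto
  finally show ?thesis .
qed

text \<open>A layer-cake estimate: the boundaries of the level sets are measured by how far the
  multiplicity \<open>c\<close> of \<open>g\<close> exceeds the multiplicity \<open>m\<close> of
  \<open>h \<mapsto> f * g h\<close>, and this excess comes from points of \<open>H\<close> outside
  \<open>f * H\<close>.\<close>

lemma sum_card_level_set_diff: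
  fixes f s :: "'a::semigroup_mult"
  assumes H: "finite H"
    and inj: "\<And>h h'. h \<in> H \<Longrightarrow> h' \<in> H \<Longrightarrow> f * (h * s) = f * (h' * s) \<Longrightarrow> h * s = h' * s"
  defines "g \<equiv> \<lambda>h. h * s"
  shows "(\<Sum>i<card H. card (level_set g H i - (\<lambda>y. f * y) ` level_set g H i))
           \<le> card (H - (\<lambda>h. f * h) ` H)"
proof -
  define c where "c = (\<lambda>y. card {h\<in>H. g h = y})"
  define m where "m = (\<lambda>y. card {h\<in>H. f * g h = y})"
  let ?D = "H - (\<lambda>h. f * h) ` H"
  \<comment> \<open>By \<open>inj\<close>, the fibre of \<open>h \<mapsto> f * g h\<close> over
    \<open>y\<close> lies in a single fibre of \<open>g\<close>. If it has more than
    \<open>i\<close> elements, that fibre of \<open>g\<close> puts a preimage of \<open>y\<close>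
    into the level set.\<close>
  have sub: "level_set g H i - (\<lambda>y. f * y) ` level_set g H i \<subseteq> {y\<in>g ` H. m y \<le> i \<and> i < c y}" for i
  proof
    fix y assume y: "y \<in> level_set g H i - (\<lambda>y. f * y) ` level_set g H i"
    have "m y \<le> i"
    proof (rule ccontr)
      assume *: "\<not> m y \<le> i"
      then have "{h\<in>H. f * g h = y} \<noteq> {}" unfolding m_def by (metis card.empty le0)
      then obtain h where h: "h \<in> H" "f * g h = y" by blast
      have "{h'\<in>H. f * g h' = y} \<subseteq> {h'\<in>H. g h' = g h}"
        using h inj by (auto simp: g_def)
      then have "m y \<le> c (g h)" unfolding m_def c_def using H by (intro card_mono) auto
      with * h have "g h \<in> level_set g H i" by (auto simp: level_set_def c_def)
      with h y show False by blast
    qed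
    with y show "y \<in> {y\<in>g ` H. m y \<le> i \<and> i < c y}" by (auto simp: level_set_def c_def)
  qed
  \<comment> \<open>A point \<open>h = f * h'\<close> with \<open>g h = y\<close> satisfies
    \<open>f * g h' = y\<close> by associativity, so at most \<open>m y\<close> points of the fibre
    lie in \<open>f * H\<close>.\<close>
  have cm: "c y - m y \<le> card {h\<in>?D. g h = y}" for y
  proof -
    have "{h\<in>H. g h = y} \<subseteq> {h\<in>?D. g h = y} \<union> (\<lambda>h. f * h) ` {h\<in>H. f * g h = y}"
      by (auto simp: g_def mult.assoc)
    then have "c y \<le> card ({h\<in>?D. g h = y} \<union> (\<lambda>h. f * h) ` {h\<in>H. f * g h = y})"
      unfolding c_def using H by (intro card_mono) auto
    also have "\<dots> \<le> card {h\<in>?D. g h = y} + card ((\<lambda>h. f * h) ` {h\<in>H. f * g h = y})"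
      by (rule card_Un_le)
    also have "card ((\<lambda>h. f * h) ` {h\<in>H. f * g h = y}) \<le> m y"
      unfolding m_def using H by (intro card_image_le) auto
    finally show ?thesis by simp
  qed
  have "(\<Sum>i<card H. card (level_set g H i - (\<lambda>y. f * y) ` level_set g H i))
      \<le> (\<Sum>i<card H. card {y\<in>g ` H. m y \<le> i \<and> i < c y})"
    using H sub by (intro sum_mono card_mono) auto
  also have "\<dots> = (\<Sum>y\<in>g ` H. c y - m y)"
    using H by (intro sum_card_levels) (auto simp: c_def intro: card_mono)
  also have "\<dots> \<le> (\<Sum>y\<in>g ` H. card {h\<in>?D. g h = y})"
    by (intro sum_mono cm)
  also have "\<dots> = card {h\<in>?D. g h \<in> g ` H}"
    using H by (intro sum_card_fibres) auto
  also have "\<dots> \<le> card ?D"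
    using H by (intro card_mono) auto
  finally show ?thesis .
qed

text \<open>Averaging over all levels produces one level that is good for \<open>A\<close> and for every
  \<open>f \<in> F\<close> simultaneously.\<close>

lemma exists_folner_level_set:
  fixes F :: "'a::semigroup_mult set"
  assumes F: "finite F" and \<epsilon>: "\<epsilon> > 0" and \<eta>: "0 < \<eta>" "\<eta> \<le> u"
    and H: "folner_set F (\<eta> * \<epsilon> / (real (card F) + 1)) H" "H \<noteq> {}"
    and inj: "\<And>f h h'. f \<in> F \<Longrightarrow> h \<in> H \<Longrightarrow> h' \<in> H \<Longrightarrow> f * (h * s) = f * (h' * s) \<Longrightarrow> h * s = h' * s"
    and u: "u * real (card H) \<le> real (card {h\<in>H. h * s \<in> A})"
  shows "\<exists>H'. folner_set F \<epsilon> H' \<and> (u - \<eta>) * real (card H') \<le> real (card (A \<inter> H'))"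
proof -
  define X where "X = level_set (\<lambda>h. h * s) H"
  have finH: "finite H" using H by (simp add: folner_set_def)
  have cH: "0 < real (card H)" using H finH by (simp add: card_gt_0_iff)
  define D where "D = (\<lambda>i f. real (card (X i - (\<lambda>y. f * y) ` X i)))"
  \<comment> \<open>A level with \<open>\<Phi> i > 0\<close> meets both requirements: the density
    bound since the \<open>D i f\<close> are nonnegative, and the Folner bound since
    \<open>u - \<eta> \<ge> 0\<close> and \<open>A \<inter> X i \<subseteq> X i\<close>.\<close>
  define \<Phi> where "\<Phi> = (\<lambda>i. real (card (A \<inter> X i)) - (u - \<eta>) * real (card (X i)) - (\<Sum>f\<in>F. D i f) / \<epsilon>)"
  have sA: "(\<Sum>i<card H. real (card (A \<inter> X i))) = real (card {h\<in>H. h * s \<in> A})"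
    unfolding X_def by (simp add: sum_card_level_set[OF finH] flip: of_nat_sum)
  have sX: "(\<Sum>i<card H. real (card (X i))) = real (card H)"
    using sum_card_level_set[OF finH, of UNIV "\<lambda>h. h * s"] unfolding X_def
    by (simp flip: of_nat_sum)
  have "(\<Sum>i<card H. \<Sum>f\<in>F. D i f) = (\<Sum>f\<in>F. \<Sum>i<card H. D i f)"
    by (rule sum.swap)
  also have "\<dots> \<le> (\<Sum>f\<in>F. \<eta> * \<epsilon> / (real (card F) + 1) * real (card H))"
  proof (rule sum_mono)
    fix f assume f: "f \<in> F"
    have "(\<Sum>i<card H. D i f) \<le> real (card (H - (\<lambda>h. f * h) ` H))"
      using sum_card_level_set_diff[OF finH inj[OF f]]
      unfolding D_def X_def by (simp flip: of_nat_sum)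
    also have "\<dots> \<le> \<eta> * \<epsilon> / (real (card F) + 1) * real (card H)"
      using H f by (auto simp: folner_set_def less_imp_le)
    finally show "(\<Sum>i<card H. D i f) \<le> \<eta> * \<epsilon> / (real (card F) + 1) * real (card H)" .
  qed
  \<comment> \<open>The \<open>+ 1\<close> in the Folner constant makes the last factor strictly
    less than 1, so the total boundary error stays strictly below the gain
    \<open>\<eta> * real (card H)\<close>.\<close>
  also have "\<dots> = \<epsilon> * (\<eta> * real (card H)) * (real (card F) / (real (card F) + 1))"
    by simp
  also have "\<dots> < \<epsilon> * (\<eta> * real (card H)) * 1"
    using \<epsilon> \<eta> cH by (intro mult_strict_left_mono) (auto simp: divide_less_eq)
  finally have sD: "(\<Sum>i<card H. \<Sum>f\<in>F. D i f) / \<epsilon> < \<eta> * real (card H)"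
    using \<epsilon> by (simp add: pos_divide_less_eq mult.commute)
  have "(\<Sum>i<card H. \<Phi> i) = (\<Sum>i<card H. real (card (A \<inter> X i)))
      - (u - \<eta>) * (\<Sum>i<card H. real (card (X i))) - (\<Sum>i<card H. \<Sum>f\<in>F. D i f) / \<epsilon>"
    unfolding \<Phi>_def by (simp add: sum_subtractf sum_distrib_left sum_divide_distrib)
  then have "0 < (\<Sum>i<card H. \<Phi> i)"
    unfolding sA sX using u sD by (simp add: algebra_simps)
  then obtain i where i: "0 < \<Phi> i"
    by (metis (no_types, lifting) not_le sum_nonpos)
  have D0: "0 \<le> D i f" for f by (simp add: D_def)
  have AX: "card (A \<inter> X i) \<le> card (X i)"
    unfolding X_def by (intro card_mono finite_level_set finH) auto
  have uX: "0 \<le> (u - \<eta>) * real (card (X i))" using \<eta> by simp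
  have "0 \<le> (\<Sum>f\<in>F. D i f) / \<epsilon>" using D0 \<epsilon> by (simp add: sum_nonneg)
  with i have "(u - \<eta>) * real (card (X i)) \<le> real (card (A \<inter> X i))"
    unfolding \<Phi>_def by linarith
  moreover have "D i f < \<epsilon> * real (card (X i))" if "f \<in> F" for f
  proof -
    have "D i f / \<epsilon> \<le> (\<Sum>f\<in>F. D i f) / \<epsilon>"
      using \<epsilon> F that D0 by (intro divide_right_mono member_le_sum) auto
    with i AX uX have "D i f / \<epsilon> < real (card (X i))" unfolding \<Phi>_def by linarith
    then show ?thesis using \<epsilon> by (simp add: pos_divide_less_eq mult.commute)
  qed
  ultimately show ?thesis
    unfolding folner_set_def D_def X_def using finite_level_set[OF finH] by blast
qed

subsection \<open>Folner sets of large relative density\<close>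

text \<open>By associativity \<open>(f * h) * s\<close> lies in \<open>f * (H * s)\<close>, so
  boundary points of \<open>H * s\<close> come from boundary points of \<open>H\<close>; injectivity
  keeps the size of \<open>H\<close>.\<close>

lemma folner_set_translate:
  fixes s :: "'a::semigroup_mult"
  assumes H: "folner_set F \<epsilon> H" and inj: "inj_on (\<lambda>h. h * s) H"
  shows "folner_set F \<epsilon> ((\<lambda>h. h * s) ` H)"
  unfolding folner_set_def
proof (intro conjI ballI)
  have finH: "finite H" using H by (simp add: folner_set_def)
  then show "finite ((\<lambda>h. h * s) ` H)" by simp
  fix f assume f: "f \<in> F"
  have "(\<lambda>h. h * s) ` H - (*) f ` (\<lambda>h. h * s) ` H \<subseteq> (\<lambda>h. h * s) ` (H - (*) f ` H)"
    by (auto simp: mult.assoc image_image)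
  then have "card ((\<lambda>h. h * s) ` H - (*) f ` (\<lambda>h. h * s) ` H) \<le> card (H - (*) f ` H)"
    using finH by (meson card_image_le card_mono finite_Diff finite_imageI order_trans)
  then have "real (card ((\<lambda>h. h * s) ` H - (*) f ` (\<lambda>h. h * s) ` H)) \<le> real (card (H - (*) f ` H))"
    by simp
  also have "real (card (H - (*) f ` H)) < \<epsilon> * real (card H)"
    using H f by (simp add: folner_set_def)
  finally show "real (card ((\<lambda>h. h * s) ` H - (*) f ` (\<lambda>h. h * s) ` H))
      < \<epsilon> * real (card ((\<lambda>h. h * s) ` H))"
    using inj by (simp add: card_image)
qed

text \<open>The witnesses for the individual pairs are multiplied together. Right multiplication
  preserves equalities already achieved, and commutativity allows the new factor to act
  first.\<close>

lemma commutative_equalizer: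
  fixes Q :: "('a::semigroup_mult \<times> 'a) set"
  assumes comm: "\<And>a b :: 'a. a * b = b * a" and "finite Q"
  shows "\<exists>c. \<forall>(x, y)\<in>Q. (\<exists>d. x * d = y * d) \<longrightarrow> x * c = y * c"
  using \<open>finite Q\<close>
proof (induction Q rule: finite_induct)
  case (insert q Q)
  obtain x y where q: "q = (x, y)" by force
  obtain c where c: "\<forall>(x, y)\<in>Q. (\<exists>d. x * d = y * d) \<longrightarrow> x * c = y * c"
    using insert by blast
  show ?case
  proof (cases "\<exists>d. x * d = y * d")
    case True
    then obtain d where d: "x * d = y * d" by blast
    have "x * (c * d) = y * (c * d)"
      using d by (metis comm mult.assoc)
    moreover have "a * (c * d) = b * (c * d)" if "a * c = b * c" for a b
      using that by (metis mult.assoc)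
    ultimately show ?thesis using c unfolding q by (intro exI[of _ "c * d"]) blast
  next
    case False
    then show ?thesis using c unfolding q by (intro exI[of _ c]) blast
  qed
qed simp

lemma mean_imp_folner_set:
  fixes A :: "'a::semigroup_mult set"
  assumes S: "SFC_plus TYPE('a)" and L: "left_invariant_mean L"
    and \<eta>: "0 < \<eta>" "\<eta> \<le> L (indicator A)" and F: "finite F" and \<epsilon>: "\<epsilon> > 0"
  shows "\<exists>H. folner_set F \<epsilon> H \<and> (L (indicator A) - \<eta>) * real (card H) \<le> real (card (A \<inter> H))"
proof -
  let ?u = "L (indicator A)"
  \<comment> \<open>The first bound serves the direct translate in the right cancellative case, the
    second the level set argument in the other two.\<close>
  define \<epsilon>' where "\<epsilon>' = min \<epsilon> (\<eta> * \<epsilon> / (real (card F) + 1))"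
  have "\<epsilon>' > 0" using \<epsilon> \<eta> by (simp add: \<epsilon>'_def add_nonneg_pos)
  moreover have "finite (insert undefined F)" using F by simp
  \<comment> \<open>The added element keeps \<open>H\<close> nonempty when \<open>F\<close> is empty.\<close>
  ultimately obtain H where H: "folner_set (insert undefined F) \<epsilon>' H"
    using S unfolding SFC_plus_def SFC_def by blast
  have finH: "finite H" and ne: "H \<noteq> {}" using H by (auto simp: folner_set_def)
  have H': "folner_set F \<delta> H" if "\<epsilon>' \<le> \<delta>" for \<delta>
    using H mult_right_mono[OF that, of "real (card H)"] unfolding folner_set_def by fastforce
  consider (right) "right_cancellative TYPE('a)" | (left) "left_cancellative TYPE('a)"
    | (comm) "commutative_semigroup TYPE('a)"
    using S unfolding SFC_plus_def by blast
  then show ?thesis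
  proof cases
    case right
    then have inj: "inj_on (\<lambda>h. h * s) H" for s
      unfolding right_cancellative_def by (auto intro: inj_onI)
    obtain s where s: "?u * real (card H) \<le> real (card {h\<in>H. h * s \<in> A})"
      using mean_family_translate[OF L finH, of A "\<lambda>h. h"] by blast
    let ?T = "(\<lambda>h. h * s) ` H"
    have "A \<inter> ?T = (\<lambda>h. h * s) ` {h\<in>H. h * s \<in> A}" by auto
    moreover have "card ((\<lambda>h. h * s) ` {h\<in>H. h * s \<in> A}) = card {h\<in>H. h * s \<in> A}"
      by (intro card_image inj_on_subset[OF inj]) auto
    ultimately have "?u * real (card ?T) \<le> real (card (A \<inter> ?T))"
      using s inj by (simp add: card_image)
    moreover have "(?u - \<eta>) * real (card ?T) \<le> ?u * real (card ?T)"
      using \<eta> by (intro mult_right_mono) auto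
    moreover have "folner_set F \<epsilon> ?T"
      by (intro folner_set_translate H' inj) (simp add: \<epsilon>'_def)
    ultimately show ?thesis by (intro exI[of _ ?T]) simp
  next
    case left
    obtain s where s: "?u * real (card H) \<le> real (card {h\<in>H. h * s \<in> A})"
      using mean_family_translate[OF L finH, of A "\<lambda>h. h"] by blast
    show ?thesis
      by (rule exists_folner_level_set[OF F \<epsilon> \<eta> H' ne _ s])
        (use left in \<open>auto simp: \<epsilon>'_def left_cancellative_def\<close>)
  next
    case comm
    then have comm': "a * b = b * a" for a b :: 'a by (simp add: commutative_semigroup_def)
    obtain c where c: "\<And>h h' d. h \<in> H \<Longrightarrow> h' \<in> H \<Longrightarrow> h * d = h' * d \<Longrightarrow> h * c = h' * c"
      using commutative_equalizer[OF comm', of "H \<times> H"] finH by fastforce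
    \<comment> \<open>The mean is applied to the family \<open>h * c\<close>, so that the good
      translate has the form \<open>c * t\<close> and keeps the identifications made by
      \<open>c\<close>.\<close>
    obtain t where t: "?u * real (card H) \<le> real (card {h\<in>H. h * c * t \<in> A})"
      using mean_family_translate[OF L finH, of A "\<lambda>h. h * c"] by blast
    have "h * (c * t) = h' * (c * t)" if "h \<in> H" "h' \<in> H" "f * (h * (c * t)) = f * (h' * (c * t))"
      for f h h'
    proof -
      \<comment> \<open>Commutativity moves \<open>f\<close> to the right, so
        \<open>c * t * f\<close> identifies \<open>h\<close> and \<open>h'\<close>; hence
        \<open>c\<close> already does.\<close>
      have "h * (c * t * f) = h' * (c * t * f)" using that(3) by (metis comm' mult.assoc)
      then have "h * c = h' * c" using c that by blast
      then show ?thesis by (metis mult.assoc)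
    qed
    then show ?thesis
      using t by (intro exists_folner_level_set[OF F \<epsilon> \<eta> H' ne, where s = "c * t"])
        (auto simp: \<epsilon>'_def mult.assoc)
  qed
qed

section \<open>Chain of inequalities between the four suprema\<close>

theorem theorem3p5:
  fixes A :: "'a::semigroup_mult set"
  assumes "SFC_plus TYPE('a)"
  shows "folner_density A = upper_banach_density A
    \<and> upper_banach_density A =
        Sup {\<delta>::real. \<delta> \<ge> 0 \<and> (\<forall>F :: 'a set. finite F \<longrightarrow>
          (\<exists>s. real (card (F \<inter> right_quotient A s)) \<ge> \<delta> * real (card F)))}
    \<and> upper_banach_density A =
        Sup {\<delta>::real. \<delta> \<ge> 0 \<and> (\<forall>M :: 'a multiset.
          (\<exists>s. real (size (filter_mset (\<lambda>t. t \<in> right_quotient A s) M)) \<ge> \<delta> * real (size M)))}"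
proof -
  define U where "U = {L (indicator A) | L. left_invariant_mean (L :: ('a \<Rightarrow> real) \<Rightarrow> real)}"
  define PF where "PF = {\<delta>::real. \<delta> \<ge> 0 \<and> (\<forall>F \<epsilon>. finite F \<longrightarrow> \<epsilon> > 0 \<longrightarrow>
        (\<exists>H. folner_set F \<epsilon> H \<and> real (card (A \<inter> H)) \<ge> \<delta> * real (card H)))}"
  define P1 where "P1 = {\<delta>::real. \<delta> \<ge> 0 \<and> (\<forall>F :: 'a set. finite F \<longrightarrow>
          (\<exists>s. real (card (F \<inter> right_quotient A s)) \<ge> \<delta> * real (card F)))}"
  define P2 where "P2 = {\<delta>::real. \<delta> \<ge> 0 \<and> (\<forall>M :: 'a multiset.
          (\<exists>s. real (size (filter_mset (\<lambda>t. t \<in> right_quotient A s) M)) \<ge> \<delta> * real (size M)))}"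
  have sfc: "\<exists>H :: 'a set. folner_set F \<epsilon> H" if "finite F" "\<epsilon> > 0" for F \<epsilon>
    using assms that unfolding SFC_plus_def SFC_def by blast
  have UP2: "U \<subseteq> P2"
    unfolding U_def P2_def using mean_indicator_bounds mean_multiset_translate by blast
  have P2P1: "P2 \<subseteq> P1"
  proof
    fix \<delta> assume \<delta>: "\<delta> \<in> P2"
    have "\<exists>s. real (card (F \<inter> right_quotient A s)) \<ge> \<delta> * real (card F)" if "finite F" for F :: "'a set"
    proof -
      obtain s where "real (size (filter_mset (\<lambda>t. t \<in> right_quotient A s) (mset_set F)))
          \<ge> \<delta> * real (size (mset_set F))"
        using \<delta> unfolding P2_def by blast
      then show ?thesis using that
        by (intro exI[of _ s]) (simp add: filter_mset_mset_set Int_def)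
    qed
    then show "\<delta> \<in> P1" using \<delta> unfolding P1_def P2_def by blast
  qed
  \<comment> \<open>A Folner set \<open>H\<close> is tested against the covering property, and right
    translation by the resulting \<open>s\<close> serves as \<open>g\<close>.\<close>
  have P1U: "\<exists>u\<in>U. \<delta> \<le> u" if \<delta>: "\<delta> \<in> P1" for \<delta>
  proof -
    have "\<exists>L. left_invariant_mean L \<and> \<delta> \<le> L (indicator A)"
    proof (rule exists_mean)
      fix F :: "'a set" and \<epsilon> :: real
      assume F: "finite F" "\<epsilon> > 0"
      obtain H where H: "folner_set F \<epsilon> H" using sfc[OF F] by blast
      then have "finite H" by (simp add: folner_set_def)
      then obtain s where "real (card (H \<inter> right_quotient A s)) \<ge> \<delta> * real (card H)"
        using \<delta> unfolding P1_def by blast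
      then show "\<exists>H g. folner_set F \<epsilon> H \<and> (\<forall>x y. g (x * y) = x * g y) \<and>
            \<delta> * real (card H) \<le> real (card {h\<in>H. g h \<in> A})"
        using H by (intro exI[of _ H] exI[of _ "\<lambda>h. h * s"])
          (simp add: mult.assoc right_quotient_def Int_def)
    qed
    then show ?thesis unfolding U_def by blast
  qed
  have PFU: "\<exists>u\<in>U. \<delta> \<le> u" if \<delta>: "\<delta> \<in> PF" for \<delta>
  proof -
    have "\<exists>L. left_invariant_mean L \<and> \<delta> \<le> L (indicator A)"
    proof (rule exists_mean)
      fix F :: "'a set" and \<epsilon> :: real
      assume "finite F" "\<epsilon> > 0"
      then obtain H where "folner_set F \<epsilon> H" "real (card (A \<inter> H)) \<ge> \<delta> * real (card H)"
        using \<delta> unfolding PF_def by blast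
      then show "\<exists>H g. folner_set F \<epsilon> H \<and> (\<forall>x y. g (x * y) = x * g y) \<and>
            \<delta> * real (card H) \<le> real (card {h\<in>H. g h \<in> A})"
        by (intro exI[of _ H] exI[of _ "\<lambda>h. h"]) (simp add: Int_def conj_commute)
    qed
    then show ?thesis unfolding U_def by blast
  qed
  have UPF: "u - \<eta> \<in> PF" if "u \<in> U" "0 < \<eta>" "\<eta> \<le> u" for u \<eta>
    using that mean_imp_folner_set[OF assms] unfolding U_def PF_def by fastforce
  have PF0: "0 \<in> PF" unfolding PF_def using sfc by simp
  \<comment> \<open>Existence of an invariant mean follows from the Folner condition through
    \<open>0 \<in> PF\<close>.\<close>
  have U_ne: "U \<noteq> {}" using PFU[OF PF0] by blast
  have U_le: "u \<le> 1" if "u \<in> U" for u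
    using that mean_indicator_bounds unfolding U_def by blast
  have bdd: "bdd_above U" "bdd_above P1" "bdd_above P2" "bdd_above PF"
    using U_le P1U PFU P2P1 by (meson bdd_aboveI subsetD order_trans)+
  have "Sup PF = Sup U"
  proof (rule antisym)
    show "Sup PF \<le> Sup U"
      using PF0 bdd PFU by (intro cSup_mono) auto
    show "Sup U \<le> Sup PF"
    proof (rule cSup_least[OF U_ne])
      fix u assume u: "u \<in> U"
      show "u \<le> Sup PF"
      proof (rule field_le_epsilon)
        fix \<eta> :: real assume "\<eta> > 0"
        show "u \<le> Sup PF + \<eta>"
        \<comment> \<open>For \<open>\<eta> > u\<close> the number \<open>u - \<eta>\<close> is
          negative and so outside \<open>PF\<close>; \<open>0 \<in> PF\<close> takes its
          place.\<close>
        proof (cases "\<eta> \<le> u")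
          case True
          then show ?thesis
            using cSup_upper[OF UPF[OF u \<open>\<eta> > 0\<close>] bdd(4)] by simp
        next
          case False
          then show ?thesis using cSup_upper[OF PF0 bdd(4)] by simp
        qed
      qed
    qed
  qed
  moreover have "Sup U \<le> Sup P2"
    using U_ne bdd(3) UP2 by (rule cSup_subset_mono)
  moreover have "Sup P2 \<le> Sup P1"
    using U_ne UP2 bdd(2) P2P1 by (intro cSup_subset_mono) auto
  moreover have "Sup P1 \<le> Sup U"
    using U_ne UP2 P2P1 bdd(1) P1U by (intro cSup_mono) auto
  ultimately show ?thesis
    unfolding folner_density_def upper_banach_density_def
    unfolding U_def[symmetric] PF_def[symmetric] P1_def[symmetric] P2_def[symmetric] by linarith
qed

end
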